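(* Let $L/K$ be a Galois extension of finite odd degree $n=[L:K]$ with Galois group $G$, and set $m=(n-1)/2$. Enumerate the elements of $G$ as $1,\sigma_1,\sigma_1^{-1},\ldots,\sigma_m,\sigma_m^{-1}$, and put $A^i=\{f_{b,\sigma_i}: b\in L\}$ for $1\le i\le m$. Then there is a direct sum decomposition $$\operatorname{Alt}(L)=A^1\oplus\cdots\oplus A^m,$$ where each subspace $A^i$ has dimension $n$ over $K$. Moreover, if $\sigma_i$ has order $2r_i+1$, then the non-zero elements of $A^i$ all have rank $$n-\frac{n}{2r_i+1}.$$
   Context: $L$ is regarded as an $n$-dimensional vector space over $K$. $\operatorname{Alt}(L)$ is the $K$-vector space (of dimension $n(n-1)/2$) of all alternating $K$-bilinear forms $L\times L\to K$ (bilinear $f$ with $f(x,x)=0$ for all $x$). $\operatorname{Tr}=\operatorname{Tr}^L_K:L\to K$ is the trace, $\operatorname{Tr}(x)=\sum_{\tau\in G}\tau(x)$. For $b\in L$ and a non-identity $\sigma\in G$, $f_{b,\sigma}\in\operatorname{Alt}(L)$ is the form $f_{b,\sigma}(x,y)=\operatorname{Tr}\big(b(x\sigma(y)-\sigma(x)y)\big)$. The rank of an alternating form $f$ is $n-\dim_K R$, where $R=\{x\in L: f(x,y)=0 \text{ for all } y\in L\}$ is its radical. *)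

theory Defs
  imports Complex_Main "HOL-Library.Function_Algebras" "HOL-Algebra.Multiplicative_Group"
begin

text \<open>
  An extension \<open>L/K\<close> is an embedding \<open>\<iota>\<close> of a field \<open>K\<close> (the type \<open>'k\<close>) into a field \<open>L\<close>
  (the type \<open>'l\<close>). Forms \<open>L \<times> L \<rightarrow> K\<close> are curried functions; they are added pointwise.
\<close>

locale field_extension =
  fixes \<iota> :: "'k::field \<Rightarrow> 'l::field"
  assumes emb_one: "\<iota> 1 = 1"
    and emb_add: "\<iota> (a + b) = \<iota> a + \<iota> b"
    and emb_mult: "\<iota> (a * b) = \<iota> a * \<iota> b"

definition ext_scale :: "('k::field \<Rightarrow> 'l::field) \<Rightarrow> 'k \<Rightarrow> 'l \<Rightarrow> 'l" where
  "ext_scale \<iota> a x = \<iota> a * x"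

definition form_scale :: "'k::field \<Rightarrow> ('l \<Rightarrow> 'l \<Rightarrow> 'k) \<Rightarrow> ('l \<Rightarrow> 'l \<Rightarrow> 'k)" where
  "form_scale a f = (\<lambda>x y. a * f x y)"

definition ext_degree :: "('k::field \<Rightarrow> 'l::field) \<Rightarrow> nat" where
  "ext_degree \<iota> = vector_space.dim (ext_scale \<iota>) UNIV"

definition galois_group :: "('k::field \<Rightarrow> 'l::field) \<Rightarrow> ('l \<Rightarrow> 'l) monoid" where
  "galois_group \<iota> =
    \<lparr>carrier = {\<tau>. bij \<tau> \<and> (\<forall>x y. \<tau> (x + y) = \<tau> x + \<tau> y) \<and>
        (\<forall>x y. \<tau> (x * y) = \<tau> x * \<tau> y) \<and> (\<forall>a. \<tau> (\<iota> a) = \<iota> a)},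
     mult = (\<circ>), one = id\<rparr>"

text \<open>A finite extension is Galois iff the fixed field of its automorphism group is the base field.\<close>

locale finite_galois_extension = field_extension \<iota> for \<iota> :: "'k::field \<Rightarrow> 'l::field" +
  assumes finite_extension: "\<exists>B. finite B \<and> module.span (ext_scale \<iota>) B = UNIV"
    and fixed_field: "{x. \<forall>\<tau>\<in>carrier (galois_group \<iota>). \<tau> x = x} = range \<iota>"

text \<open>The trace lies in \<open>range \<iota>\<close> and is pulled back to \<open>K\<close>; see \<open>emb_gal_trace\<close> below.\<close>

definition gal_trace :: "('k::field \<Rightarrow> 'l::field) \<Rightarrow> 'l \<Rightarrow> 'k" where
  "gal_trace \<iota> x = (THE a. \<iota> a = (\<Sum>\<tau>\<in>carrier (galois_group \<iota>). \<tau> x))"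

definition alternating_forms :: "('k::field \<Rightarrow> 'l::field) \<Rightarrow> ('l \<Rightarrow> 'l \<Rightarrow> 'k) set" where
  "alternating_forms \<iota> =
    {f. (\<forall>y. Vector_Spaces.linear (ext_scale \<iota>) (*) (\<lambda>x. f x y)) \<and>
        (\<forall>x. Vector_Spaces.linear (ext_scale \<iota>) (*) (\<lambda>y. f x y)) \<and>
        (\<forall>x. f x x = 0)}"

definition galois_form :: "('k::field \<Rightarrow> 'l::field) \<Rightarrow> 'l \<Rightarrow> ('l \<Rightarrow> 'l) \<Rightarrow> 'l \<Rightarrow> 'l \<Rightarrow> 'k" where
  "galois_form \<iota> b \<sigma> = (\<lambda>x y. gal_trace \<iota> (b * (x * \<sigma> y - \<sigma> x * y)))"

definition galois_forms :: "('k::field \<Rightarrow> 'l::field) \<Rightarrow> ('l \<Rightarrow> 'l) \<Rightarrow> ('l \<Rightarrow> 'l \<Rightarrow> 'k) set" where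
  "galois_forms \<iota> \<sigma> = {galois_form \<iota> b \<sigma> | b. True}"

definition form_radical :: "('l \<Rightarrow> 'l \<Rightarrow> 'k::field) \<Rightarrow> 'l set" where
  "form_radical f = {x. \<forall>y. f x y = 0}"

definition form_rank :: "('k::field \<Rightarrow> 'l::field) \<Rightarrow> ('l \<Rightarrow> 'l \<Rightarrow> 'k) \<Rightarrow> nat" where
  "form_rank \<iota> f = ext_degree \<iota> - vector_space.dim (ext_scale \<iota>) (form_radical f)"

text \<open>Internal direct sum of a finite family of subspaces.\<close>

definition is_direct_sum ::
    "('k::field \<Rightarrow> 'v::ab_group_add \<Rightarrow> 'v) \<Rightarrow> 'v set \<Rightarrow> 'i set \<Rightarrow> ('i \<Rightarrow> 'v set) \<Rightarrow> bool" where
  "is_direct_sum scale V I A \<longleftrightarrow>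
    (\<forall>i\<in>I. module.subspace scale (A i)) \<and>
    {\<Sum>i\<in>I. g i | g. \<forall>i\<in>I. g i \<in> A i} = V \<and>
    (\<forall>g h. (\<forall>i\<in>I. g i \<in> A i \<and> h i \<in> A i) \<and> (\<Sum>i\<in>I. g i) = (\<Sum>i\<in>I. h i) \<longrightarrow>
       (\<forall>i\<in>I. g i = h i))"

text \<open>
  \<open>dim\<close>, \<open>span\<close>, \<open>subspace\<close>, \<open>ord\<close> and the group inverse are specified only under the axioms
  of \<^locale>\<open>vector_space\<close> and \<^locale>\<open>group\<close>, which hold here.
\<close>

lemma vector_space_ext_scale:
  assumes "field_extension \<iota>"
  shows "vector_space (ext_scale \<iota>)"
proof -
  interpret field_extension \<iota> by fact
  show ?thesis
    by unfold_locales (simp_all add: ext_scale_def emb_one emb_add emb_mult algebra_simps)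
qed

lemma vector_space_form_scale: "vector_space form_scale"
  by unfold_locales (auto simp: form_scale_def fun_eq_iff algebra_simps)

lemma group_galois_group: "group (galois_group \<iota>)"
proof (rule groupI)
  fix \<tau> assume t: "\<tau> \<in> carrier (galois_group \<iota>)"
  let ?t = "inv_into UNIV \<tau>"
  from t have b: "bij \<tau>" and a: "\<And>x y. \<tau> (x + y) = \<tau> x + \<tau> y"
    and m: "\<And>x y. \<tau> (x * y) = \<tau> x * \<tau> y" and i: "\<And>a. \<tau> (\<iota> a) = \<iota> a"
    by (auto simp: galois_group_def)
  have s: "\<tau> (?t x) = x" and s': "?t (\<tau> x) = x" for x
    using b by (auto simp: bij_def surj_f_inv_f)
  have "?t (x + y) = ?t x + ?t y" for x y by (metis a s s')
  moreover have "?t (x * y) = ?t x * ?t y" for x y by (metis m s s')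
  moreover have "?t (\<iota> c) = \<iota> c" for c by (metis i s')
  ultimately have "?t \<in> carrier (galois_group \<iota>)"
    using bij_imp_bij_inv[OF b] by (auto simp: galois_group_def)
  moreover have "?t \<otimes>\<^bsub>galois_group \<iota>\<^esub> \<tau> = \<one>\<^bsub>galois_group \<iota>\<^esub>"
    by (auto simp: galois_group_def s' fun_eq_iff)
  ultimately show "\<exists>y\<in>carrier (galois_group \<iota>). y \<otimes>\<^bsub>galois_group \<iota>\<^esub> \<tau> = \<one>\<^bsub>galois_group \<iota>\<^esub>"
    by blast
qed (auto simp: galois_group_def o_assoc intro: bij_comp)

lemma emb_gal_trace:
  assumes "finite_galois_extension \<iota>"
  shows "\<iota> (gal_trace \<iota> x) = (\<Sum>\<tau>\<in>carrier (galois_group \<iota>). \<tau> x)"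
proof -
  interpret finite_galois_extension \<iota> by fact
  let ?G = "galois_group \<iota>" and ?s = "\<Sum>\<tau>\<in>carrier (galois_group \<iota>). \<tau> x"
  have "\<rho> ?s = ?s" if r: "\<rho> \<in> carrier ?G" for \<rho>
  proof -
    have add: "\<rho> (u + v) = \<rho> u + \<rho> v" for u v using r by (auto simp: galois_group_def)
    then have zero: "\<rho> 0 = 0" by (metis add_cancel_right_right)
    have "\<rho> (\<Sum>\<tau>\<in>S. \<tau> x) = (\<Sum>\<tau>\<in>S. (\<rho> \<circ> \<tau>) x)" for S
      by (induction S rule: infinite_finite_induct) (simp_all add: zero add)
    also have "(\<Sum>\<tau>\<in>carrier ?G. (\<rho> \<circ> \<tau>) x) = ?s"
    proof (rule sum.reindex_bij_betw)
      have "inj_on (\<lambda>\<tau>. \<rho> \<circ> \<tau>) (carrier ?G)"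
        using group.inj_on_cmult[OF group_galois_group r]
        by (simp add: galois_group_def)
      moreover have "(\<lambda>\<tau>. \<rho> \<circ> \<tau>) ` carrier ?G = carrier ?G"
        using group.surj_const_mult[OF group_galois_group r] by (simp add: galois_group_def)
      ultimately show "bij_betw (\<lambda>\<tau>. \<rho> \<circ> \<tau>) (carrier ?G) (carrier ?G)"
        by (simp add: bij_betw_def)
    qed
    finally show ?thesis .
  qed
  then have "?s \<in> range \<iota>" using fixed_field by blast
  then obtain a where a: "\<iota> a = ?s" by (metis imageE)
  have "c = d" if "\<iota> c = \<iota> d" for c d
  proof (rule ccontr)
    assume "c \<noteq> d"
    have "\<iota> (c - d) + \<iota> d = \<iota> c" by (simp flip: emb_add)
    then have "\<iota> (c - d) = 0" using that by simp
    then have "\<iota> ((c - d) * inverse (c - d)) = 0" by (simp only: emb_mult) simp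
    with \<open>c \<noteq> d\<close> show False by (simp add: emb_one)
  qed
  with a show ?thesis unfolding gal_trace_def by (metis (mono_tags, lifting) theI)
qed

end

theory Submission
  imports Defs
begin

text \<open>
  Since the trace form is nondegenerate and every \<open>K\<close>-linear map \<open>L \<rightarrow> L\<close> is an \<open>L\<close>-combination
  of elements of \<open>G\<close>, each bilinear form is \<open>f x y = Tr ((\<Sum>\<tau>\<in>G. c \<tau> * \<tau> x) * y)\<close> for exactly one \<open>c\<close>.
  Skew symmetry means \<open>c (\<tau>\<^sup>-\<^sup>1) = - \<tau>\<^sup>-\<^sup>1 (c \<tau>)\<close>, so that the terms of \<open>\<sigma> i\<close> and its inverse
  combine to an element of \<open>A i\<close>. What is left is \<open>Tr (c 1 * x\<^sup>2) = 0\<close>, and \<open>c 1 = 0\<close> in every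
  characteristic because the characters \<open>x \<mapsto> (\<tau> x)\<^sup>2\<close> are independent. The radical of
  \<open>f\<^sub>b\<^sub>,\<^sub>\<sigma>\<close> is \<open>{x. b * x = \<sigma> b * \<sigma> (\<sigma> x)}\<close>, a line over the fixed field of \<open>\<sigma>\<close> when \<open>b \<noteq> 0\<close>.
\<close>

section \<open>Independence of characters and of rows\<close>

text \<open>Gaussian elimination, one column per induction step: if column \<open>j0\<close> has a
  nonzero entry, the row \<open>i0\<close> of that entry serves as pivot, and deleting row and
  column leaves rows that are still independent.\<close>

lemma card_le_of_independent_rows:
  fixes M :: "'i \<Rightarrow> 'j \<Rightarrow> 'f::field"
  assumes "finite J" "finite I"
    and "\<And>c. \<forall>j\<in>J. (\<Sum>i\<in>I. c i * M i j) = 0 \<Longrightarrow> \<forall>i\<in>I. c i = 0"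
  shows "card I \<le> card J"
  using assms
proof (induction J arbitrary: I M rule: finite_induct)
  case empty
  \<comment> \<open>Without columns every coefficient vector is a relation, so the constant 1 forces
    \<open>I\<close> to be empty.\<close>
  from empty(2)[of "\<lambda>_. 1"] show ?case by (cases "I = {}") auto
next
  case (insert j0 J)
  show ?case
  proof (cases "\<forall>i\<in>I. M i j0 = 0")
    case True
    have "card I \<le> card J"
    proof (rule insert.IH)
      fix c assume "\<forall>j\<in>J. (\<Sum>i\<in>I. c i * M i j) = 0"
      with True show "\<forall>i\<in>I. c i = 0" by (intro insert.prems(2)) auto
    qed fact
    then show ?thesis using insert.hyps by simp
  next
    case False
    then obtain i0 where i0: "i0 \<in> I" "M i0 j0 \<noteq> 0" by auto
    define M' where "M' i j = M i j - M i j0 / M i0 j0 * M i0 j" for i j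
    have "card (I - {i0}) \<le> card J"
    proof (rule insert.IH[where M = M'])
      fix c assume c: "\<forall>j\<in>J. (\<Sum>i\<in>I - {i0}. c i * M' i j) = 0"
      \<comment> \<open>The pivot row gets the total of the multiples subtracted from the other
        rows, so a relation among the reduced rows becomes one among the original rows.\<close>
      define d where "d i = (if i = i0 then - (\<Sum>k\<in>I - {i0}. c k * M k j0 / M i0 j0) else c i)" for i
      have "(\<Sum>i\<in>I. d i * M i j) = (\<Sum>i\<in>I - {i0}. c i * M' i j)" for j
      proof -
        have "(\<Sum>i\<in>I. d i * M i j) = d i0 * M i0 j + (\<Sum>i\<in>I - {i0}. d i * M i j)"
          using insert.prems(1) i0(1) by (rule sum.remove)
        also have "(\<Sum>i\<in>I - {i0}. d i * M i j) = (\<Sum>i\<in>I - {i0}. c i * M i j)"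
          by (rule sum.cong) (auto simp: d_def)
        also have "d i0 * M i0 j + \<dots> = (\<Sum>i\<in>I - {i0}. c i * M' i j)"
          by (simp add: d_def M'_def sum_distrib_right sum_subtractf right_diff_distrib mult.assoc
              flip: sum_negf)
        finally show ?thesis .
      qed
      moreover have "M' i j0 = 0" for i using i0 by (simp add: M'_def)
      ultimately have "\<forall>i\<in>I. d i = 0"
        using c by (intro insert.prems(2)) auto
      then show "\<forall>i\<in>I - {i0}. c i = 0" by (auto simp: d_def split: if_splits)
    qed (use insert.prems(1) in simp)
    then show ?thesis using insert.hyps insert.prems(1) i0(1) by simp
  qed
qed

lemma dedekind_independence:
  fixes \<chi> :: "'i \<Rightarrow> 'a::monoid_mult \<Rightarrow> 'f::field"
  assumes "finite I" "inj_on \<chi> I"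
    and "\<And>i x y. i \<in> I \<Longrightarrow> \<chi> i (x * y) = \<chi> i x * \<chi> i y"
    and "\<And>i. i \<in> I \<Longrightarrow> \<chi> i 1 = 1"
    and "\<And>x. (\<Sum>i\<in>I. c i * \<chi> i x) = 0"
  shows "\<forall>i\<in>I. c i = 0"
  using assms
proof (induction I arbitrary: c rule: finite_induct)
  case (insert j I)
  have c0: "c k = 0" if k: "k \<in> I" for k
  proof -
    from k insert.hyps have "k \<noteq> j" by auto
    with insert.prems(1) k have "\<chi> k \<noteq> \<chi> j" by (auto simp: inj_on_def)
    then obtain z where z: "\<chi> k z \<noteq> \<chi> j z" by auto
    have "\<forall>i\<in>I. c i * (\<chi> i z - \<chi> j z) = 0"
    proof (rule insert.IH)
      fix x
      have "(\<Sum>i\<in>I. c i * (\<chi> i z - \<chi> j z) * \<chi> i x)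
          = (\<Sum>i\<in>insert j I. c i * (\<chi> i z - \<chi> j z) * \<chi> i x)"
        using insert.hyps by simp
      also have "\<dots> = (\<Sum>i\<in>insert j I. c i * \<chi> i (z * x)) - \<chi> j z * (\<Sum>i\<in>insert j I. c i * \<chi> i x)"
        unfolding sum_distrib_left sum_subtractf[symmetric]
        by (rule sum.cong) (use insert.prems(2) in \<open>auto simp: algebra_simps\<close>)
      also have "\<dots> = 0" by (simp only: insert.prems(4)) simp
      finally show "(\<Sum>i\<in>I. c i * (\<chi> i z - \<chi> j z) * \<chi> i x) = 0" .
    qed (use insert.prems in auto)
    with k z show ?thesis by auto
  qed
  moreover have "c j = 0"
    using insert.prems(4)[of 1] insert.prems(3)[of j] insert.hyps c0 by simp
  ultimately show ?case by auto
qed simp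

section \<open>Galois extensions\<close>

context finite_galois_extension
begin

abbreviation G where "G \<equiv> carrier (galois_group \<iota>)"
abbreviation tr where "tr \<equiv> gal_trace \<iota>"
abbreviation ginv where "ginv \<tau> \<equiv> inv\<^bsub>galois_group \<iota>\<^esub> \<tau>"
abbreviation klinear where "klinear \<equiv> Vector_Spaces.linear (ext_scale \<iota>)"

interpretation L: vector_space "ext_scale \<iota>"
  by (rule vector_space_ext_scale) unfold_locales

interpretation forms: vector_space form_scale
  by (rule vector_space_form_scale)

interpretation K: vector_space "(*) :: 'k \<Rightarrow> 'k \<Rightarrow> 'k"
  by unfold_locales (simp_all add: algebra_simps)

interpretation G: group "galois_group \<iota>"
  by (rule group_galois_group)

section \<open>Elementary rules for automorphisms\<close>

lemma G_add: "\<tau> \<in> G \<Longrightarrow> \<tau> (x + y) = \<tau> x + \<tau> y"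
  and G_mult: "\<tau> \<in> G \<Longrightarrow> \<tau> (x * y) = \<tau> x * \<tau> y"
  and G_emb: "\<tau> \<in> G \<Longrightarrow> \<tau> (\<iota> a) = \<iota> a"
  and G_bij: "\<tau> \<in> G \<Longrightarrow> bij \<tau>"
  and G_comp: "mult (galois_group \<iota>) = (\<circ>)"
  and G_one: "one (galois_group \<iota>) = id"
  by (auto simp: galois_group_def)

lemma G_zero: "\<tau> \<in> G \<Longrightarrow> \<tau> 0 = 0"
  by (metis G_add add_cancel_right_right)

lemma G_unit: "\<tau> \<in> G \<Longrightarrow> \<tau> 1 = 1"
  by (metis G_emb emb_one)

lemma G_minus: "\<tau> \<in> G \<Longrightarrow> \<tau> (- x) = - \<tau> x"
  by (metis G_add G_zero add_eq_0_iff)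

lemma G_sum: "\<tau> \<in> G \<Longrightarrow> \<tau> (\<Sum>i\<in>I. f i) = (\<Sum>i\<in>I. \<tau> (f i))"
  by (induction I rule: infinite_finite_induct) (simp_all add: G_zero G_add)

lemma G_prod: "\<tau> \<in> G \<Longrightarrow> \<tau> (\<Prod>i\<in>I. f i) = (\<Prod>i\<in>I. \<tau> (f i))"
  by (induction I rule: infinite_finite_induct) (simp_all add: G_unit G_mult)

lemma G_eq_0_iff: "\<tau> \<in> G \<Longrightarrow> \<tau> x = 0 \<longleftrightarrow> x = 0"
  by (metis G_bij G_zero bij_pointE)

lemma G_ginv: "\<tau> \<in> G \<Longrightarrow> \<tau> (ginv \<tau> x) = x"
  and ginv_G: "\<tau> \<in> G \<Longrightarrow> ginv \<tau> (\<tau> x) = x"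
  using G.r_inv[of \<tau>] G.l_inv[of \<tau>] by (simp_all add: G_comp G_one fun_eq_iff)

lemma G_independent:
  assumes "finite I" "I \<subseteq> G" "\<And>x. (\<Sum>\<tau>\<in>I. c \<tau> * \<tau> x) = 0" "\<tau> \<in> I"
  shows "c \<tau> = 0"
  using dedekind_independence[of I "\<lambda>\<tau>. \<tau>" c] assms by (auto simp: G_mult G_unit subset_iff)

lemma emb_zero: "\<iota> 0 = 0"
  by (metis add_cancel_right_right emb_add)

lemma emb_eq_iff: "\<iota> a = \<iota> b \<longleftrightarrow> a = b"
proof
  assume eq: "\<iota> a = \<iota> b"
  show "a = b"
  proof (rule ccontr)
    assume "a \<noteq> b"
    have "\<iota> (a - b) + \<iota> b = \<iota> a" by (simp flip: emb_add)
    then have "\<iota> ((a - b) * inverse (a - b)) = 0" by (simp add: emb_mult eq del: right_inverse)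
    with \<open>a \<noteq> b\<close> show False by (simp add: emb_one)
  qed
qed simp

section \<open>Bases of the extension and finiteness of the group\<close>

lemma obtain_basis:
  obtains B where "finite B" "L.independent B" "L.span B = UNIV" "card B = ext_degree \<iota>"
proof -
  obtain B where B: "L.independent B" "UNIV \<subseteq> L.span B" "card B = L.dim UNIV"
    using L.basis_exists[of UNIV] by metis
  obtain C where "finite C" "L.span C = UNIV" using finite_extension by auto
  with B(1) have "finite B" using L.independent_span_bound[of C B] by simp
  with B that show ?thesis by (auto simp: ext_degree_def)
qed

lemma basis_expansion:
  assumes "finite B" "L.independent B" "x \<in> L.span B"
  shows "x = (\<Sum>e\<in>B. \<iota> (L.representation B x e) * e)"
  using L.sum_representation_eq[of B x B] assms by (simp add: ext_scale_def)

lemma basis_coeff_eq_0: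
  assumes "finite B" "L.independent B" "(\<Sum>e\<in>B. \<iota> (u e) * e) = 0" "e \<in> B"
  shows "u e = 0"
  using L.independentD[of B B u e] assms by (simp add: ext_scale_def)

lemma G_basis:
  assumes "finite B" "L.independent B" "x \<in> L.span B" "\<tau> \<in> G"
  shows "\<tau> x = (\<Sum>e\<in>B. \<iota> (L.representation B x e) * \<tau> e)"
  by (subst basis_expansion[OF assms(1-3)]) (simp add: G_sum G_mult G_emb assms(4))

text \<open>An automorphism is determined by its values on a \<open>K\<close>-basis, so Dedekind
  independence makes the rows \<open>(\<tau> e)\<close> independent; hence no finite set of
  automorphisms exceeds the size of the basis.\<close>

lemma finite_G: "finite G"
proof -
  obtain B where B: "finite B" "L.independent B" "L.span B = UNIV" by (rule obtain_basis)
  have "card I \<le> card B" if I: "I \<subseteq> G" "finite I" for I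
  proof (rule card_le_of_independent_rows[where M = "\<lambda>\<tau> e. \<tau> e"])
    fix c assume c: "\<forall>e\<in>B. (\<Sum>\<tau>\<in>I. c \<tau> * \<tau> e) = 0"
    have "(\<Sum>\<tau>\<in>I. c \<tau> * \<tau> x) = 0" for x
    proof -
      have "(\<Sum>\<tau>\<in>I. c \<tau> * \<tau> x) = (\<Sum>\<tau>\<in>I. \<Sum>e\<in>B. \<iota> (L.representation B x e) * (c \<tau> * \<tau> e))"
      proof (rule sum.cong[OF refl])
        fix \<tau> assume "\<tau> \<in> I"
        then have "\<tau> x = (\<Sum>e\<in>B. \<iota> (L.representation B x e) * \<tau> e)"
          using I B by (intro G_basis) auto
        then show "c \<tau> * \<tau> x = (\<Sum>e\<in>B. \<iota> (L.representation B x e) * (c \<tau> * \<tau> e))"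
          by (simp add: sum_distrib_left mult.left_commute)
      qed
      also have "\<dots> = (\<Sum>e\<in>B. \<iota> (L.representation B x e) * (\<Sum>\<tau>\<in>I. c \<tau> * \<tau> e))"
        by (subst sum.swap) (simp add: sum_distrib_left)
      finally show ?thesis using c by simp
    qed
    then show "\<forall>\<tau>\<in>I. c \<tau> = 0" using I G_independent[of I c] by auto
  qed (use B I in auto)
  then show ?thesis by (meson finite_if_finite_subsets_card_bdd)
qed

subsection \<open>The trace form\<close>

lemma emb_tr: "\<iota> (tr x) = (\<Sum>\<tau>\<in>G. \<tau> x)"
  by (rule emb_gal_trace) unfold_locales

lemma tr_add: "tr (x + y) = tr x + tr y"
  by (simp add: emb_eq_iff[symmetric] emb_add emb_tr G_add sum.distrib)

lemma tr_scale: "tr (\<iota> a * x) = a * tr x"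
  by (simp add: emb_eq_iff[symmetric] emb_mult emb_tr G_mult G_emb sum_distrib_left)

lemma tr_zero: "tr 0 = 0"
  using tr_scale[of 0 0] by simp

lemma tr_diff: "tr (x - y) = tr x - tr y"
  using tr_add[of "x - y" y] by simp

lemma tr_minus: "tr (- x) = - tr x"
  using tr_diff[of 0 x] by (simp add: tr_zero)

lemma tr_sum: "tr (\<Sum>i\<in>I. f i) = (\<Sum>i\<in>I. tr (f i))"
  by (induction I rule: infinite_finite_induct) (simp_all add: tr_zero tr_add)

lemma sum_G_right:
  assumes "\<rho> \<in> G"
  shows "(\<Sum>\<tau>\<in>G. f (\<tau> \<circ> \<rho>)) = (\<Sum>\<tau>\<in>G. f \<tau>)"
  by (intro sum.reindex_bij_witness[of _ "\<lambda>\<tau>. \<tau> \<circ> ginv \<rho>" "\<lambda>\<tau>. \<tau> \<circ> \<rho>"])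
     (use assms G.m_closed in \<open>auto simp: G_comp[symmetric] G.m_assoc\<close>)

lemma tr_G: "\<rho> \<in> G \<Longrightarrow> tr (\<rho> x) = tr x"
  using sum_G_right[of \<rho> "\<lambda>\<tau>. \<tau> x"] by (simp add: emb_eq_iff[symmetric] emb_tr)

text \<open>Written out, the hypothesis is a relation among the elements of the group with
  coefficients \<open>\<tau> b\<close>; the coefficient of the identity is \<open>b\<close>
  itself.\<close>

lemma tr_nondegenerate:
  assumes "\<And>y. tr (b * y) = 0"
  shows "b = 0"
proof -
  have "(\<Sum>\<tau>\<in>G. \<tau> b * \<tau> x) = 0" for x
    using emb_tr[of "b * x"] assms by (simp add: G_mult emb_zero)
  then have "(one (galois_group \<iota>)) b = 0"
    by (rule G_independent[OF finite_G order_refl]) simp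
  then show ?thesis by (simp add: G_one)
qed

lemma tr_eqI:
  assumes "\<And>y. tr (a * y) = tr (b * y)"
  shows "a = b"
  using tr_nondegenerate[of "a - b"] assms by (simp add: left_diff_distrib tr_diff)

section \<open>Linear functionals and linear endomorphisms in terms of the trace and the
  group\<close>

lemma klinear_iff:
  "Vector_Spaces.linear (ext_scale \<iota>) (*) g \<longleftrightarrow>
    (\<forall>x y. g (x + y) = g x + g y) \<and> (\<forall>a x. g (\<iota> a * x) = a * g x)"
  by (auto simp: Vector_Spaces.linear_iff ext_scale_def L.vector_space_axioms K.vector_space_axioms)

lemma klinear_sum:
  assumes "klinear (*) g"
  shows "g (\<Sum>i\<in>I. \<iota> (u i) * v i) = (\<Sum>i\<in>I. u i * g (v i))"
proof -
  have "g 0 = 0" using assms unfolding klinear_iff by (metis add_cancel_right_right)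
  then show ?thesis using assms unfolding klinear_iff
    by (induction I rule: infinite_finite_induct) auto
qed

text \<open>Finite-dimensional duality: \<open>b\<close> is sent to the functional with kernel
  \<open>b\<close>, which is injective by nondegeneracy and therefore surjective.\<close>

lemma functional_eq_tr:
  assumes g: "klinear (*) g"
  obtains b where "\<And>x. g x = tr (b * x)"
proof -
  obtain B where B: "finite B" "L.independent B" "L.span B = UNIV" by (rule obtain_basis)
  interpret L: finite_dimensional_vector_space "ext_scale \<iota>" B
    by unfold_locales (use B in auto)
  \<comment> \<open>The values of the functional on the basis are stored as coordinates in the same
    basis. This replaces the dual space by \<open>L\<close>, so that an injective endomorphism is
    surjective.\<close>
  define \<Phi> where "\<Phi> b = (\<Sum>e\<in>B. \<iota> (tr (b * e)) * e)" for b
  have ext: "tr (b * x) = h x" if h: "klinear (*) h" and eq: "\<And>e. e \<in> B \<Longrightarrow> tr (b * e) = h e" for b h x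
  proof -
    have t: "klinear (*) (\<lambda>x. tr (b * x))"
      unfolding klinear_iff by (simp add: distrib_left tr_add tr_scale[symmetric] mult.left_commute)
    have x: "x = (\<Sum>e\<in>B. \<iota> (L.representation B x e) * e)"
      by (rule basis_expansion) (use B in auto)
    show ?thesis
      by (subst (1 2) x) (simp add: klinear_sum[OF t] klinear_sum[OF h] eq)
  qed
  have lin: "klinear (ext_scale \<iota>) \<Phi>"
    unfolding Vector_Spaces.linear_iff ext_scale_def[abs_def]
  proof (intro conjI allI L.vector_space_axioms[unfolded ext_scale_def[abs_def]])
    show "\<Phi> (x + y) = \<Phi> x + \<Phi> y" for x y
      by (simp add: \<Phi>_def distrib_right tr_add emb_add sum.distrib)
    show "\<Phi> (\<iota> a * x) = \<iota> a * \<Phi> x" for a x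
      by (simp add: \<Phi>_def mult.assoc tr_scale emb_mult sum_distrib_left)
  qed
  have "inj \<Phi>"
  proof -
    interpret \<Phi>: Vector_Spaces.linear "ext_scale \<iota>" "ext_scale \<iota>" \<Phi> by (rule lin)
    have "b = 0" if b0: "\<Phi> b = 0" for b
    proof (rule tr_nondegenerate)
      have "klinear (*) (\<lambda>_. 0)" unfolding klinear_iff by simp
      then show "tr (b * y) = 0" for y
        using basis_coeff_eq_0[OF B(1,2) b0[unfolded \<Phi>_def]] by (rule ext)
    qed
    then show ?thesis by (auto simp: \<Phi>.inj_iff_eq_0)
  qed
  with lin have "surj \<Phi>" by (rule L.linear_inj_imp_surj)
  then obtain b where b: "\<Phi> b = (\<Sum>e\<in>B. \<iota> (g e) * e)" by (metis surjD)
  have "tr (b * e) = g e" if "e \<in> B" for e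
  proof -
    have "(\<Sum>e\<in>B. \<iota> (tr (b * e) - g e) * e) + (\<Sum>e\<in>B. \<iota> (g e) * e) = \<Phi> b"
      unfolding \<Phi>_def by (simp flip: sum.distrib distrib_right emb_add)
    then have "tr (b * e) - g e = 0"
      using basis_coeff_eq_0[OF B(1,2) _ that, of "\<lambda>e. tr (b * e) - g e"] b by simp
    then show ?thesis by simp
  qed
  with ext[OF g, of b] that show ?thesis by metis
qed

text \<open>Each coordinate functional is some \<open>tr (d e * x)\<close>; writing the trace as a
  sum over the group and collecting the terms with \<open>\<tau> x\<close> gives the
  coefficients.\<close>

lemma klinear_expansion:
  assumes "klinear (ext_scale \<iota>) F"
  obtains c where "\<And>x. F x = (\<Sum>\<tau>\<in>G. c \<tau> * \<tau> x)"
proof -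
  interpret F: Vector_Spaces.linear "ext_scale \<iota>" "ext_scale \<iota>" F by fact
  obtain B where B: "finite B" "L.independent B" "L.span B = UNIV" by (rule obtain_basis)
  have "\<exists>d. \<forall>x. L.representation B x e = tr (d * x)" for e
  proof -
    have "klinear (*) (\<lambda>x. L.representation B x e)"
      unfolding klinear_iff using B L.representation_add[of B] L.representation_scale[of B]
      by (simp add: ext_scale_def)
    then show ?thesis by (meson functional_eq_tr)
  qed
  then obtain d where d: "\<And>e x. L.representation B x e = tr (d e * x)" by metis
  have "F x = (\<Sum>\<tau>\<in>G. (\<Sum>e\<in>B. \<tau> (d e) * F e) * \<tau> x)" for x
  proof -
    have "F x = F (\<Sum>e\<in>B. ext_scale \<iota> (tr (d e * x)) e)"
      using basis_expansion[of B x] B by (simp add: ext_scale_def d)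
    also have "\<dots> = (\<Sum>e\<in>B. \<iota> (tr (d e * x)) * F e)"
      by (simp add: F.sum F.scale) (simp add: ext_scale_def)
    also have "\<dots> = (\<Sum>e\<in>B. \<Sum>\<tau>\<in>G. \<tau> (d e) * F e * \<tau> x)"
      by (simp add: emb_tr sum_distrib_left sum_distrib_right G_mult algebra_simps)
    also have "\<dots> = (\<Sum>\<tau>\<in>G. (\<Sum>e\<in>B. \<tau> (d e) * F e) * \<tau> x)"
      by (subst sum.swap) (simp add: sum_distrib_right)
    finally show ?thesis .
  qed
  then show ?thesis by (rule that)
qed


subsection \<open>Fixed fields\<close>

definition fixed_by :: "('l \<Rightarrow> 'l) set \<Rightarrow> 'l set" where
  "fixed_by H = {x. \<forall>\<tau>\<in>H. \<tau> x = x}"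

lemma subspace_fixed_by: "H \<subseteq> G \<Longrightarrow> L.subspace (fixed_by H)"
  by (auto simp: L.subspace_def fixed_by_def ext_scale_def G_add G_mult G_emb G_zero subset_iff)

lemma sum_G_ginv: "(\<Sum>\<tau>\<in>G. f (ginv \<tau>)) = (\<Sum>\<tau>\<in>G. f \<tau>)"
  by (rule sum.reindex_bij_witness[of _ ginv ginv]) auto

lemma ginv_comp: "\<sigma> \<in> G \<Longrightarrow> \<tau> \<in> G \<Longrightarrow> ginv (\<sigma> \<circ> \<tau>) = ginv \<tau> \<circ> ginv \<sigma>"
  using G.inv_mult_group[of \<sigma> \<tau>] by (simp add: G_comp)

text \<open>Both inequalities come from the matrix \<open>(\<tau> e)\<close>, with \<open>\<tau>\<close> ranging over the cosets of
  \<open>H\<close> and \<open>e\<close> over a basis of the fixed field: its rows are independent because the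
  relative trace turns a relation among them into one among the elements of \<open>G\<close>, and its columns
  are independent because the absolute trace turns a relation over \<open>L\<close> into relations over \<open>K\<close>.\<close>

lemma dim_fixed_by_eq_card_rcosets:
  assumes H: "subgroup H (galois_group \<iota>)"
  shows "L.dim (fixed_by H) = card (rcosets\<^bsub>galois_group \<iota>\<^esub> H)"
proof -
  let ?I = "rcosets\<^bsub>galois_group \<iota>\<^esub> H"
  interpret H: subgroup H "galois_group \<iota>" by fact
  \<comment> \<open>The cosets have the form \<open>H g\<close>, and the inverse of
    \<open>h \<circ> g\<close> applies the inverse of \<open>h\<close> first. It is therefore
    \<open>ginv g\<close>, not \<open>g\<close>, whose restriction to the fixed field depends only
    on the coset.\<close>
  define rep where "rep C = (SOME g. g \<in> C)" for C :: "('l \<Rightarrow> 'l) set"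
  \<comment> \<open>The relative trace from \<open>L\<close> to the fixed field of \<open>H\<close>,
    summed over inverses to match the sums over cosets.\<close>
  define T where "T x = (\<Sum>h\<in>H. ginv h x)" for x
  have HG: "H \<subseteq> G" by (rule H.subset)
  have finI: "finite ?I"
    using G.rcosets_part_G[OF H] finite_G by (metis finite_UnionD)
  obtain B where B: "B \<subseteq> fixed_by H" "L.independent B" "fixed_by H \<subseteq> L.span B"
    "card B = L.dim (fixed_by H)"
    using L.basis_exists by metis
  obtain E where E: "finite E" "L.span E = UNIV" using finite_extension by auto
  then have finB: "finite B" using B(2) L.independent_span_bound[of E B] by simp
  have coset: "C = H #>\<^bsub>galois_group \<iota>\<^esub> g" "g \<in> G" if "C \<in> ?I" "g \<in> C" for C g
    using that G.repr_independence[OF _ _ H] H.rcosets_carrier[OF G.is_group that(1)]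
    by (auto simp: RCOSETS_def)
  have self: "H #>\<^bsub>galois_group \<iota>\<^esub> g \<in> ?I" "g \<in> H #>\<^bsub>galois_group \<iota>\<^esub> g" if "g \<in> G" for g
    using that G.rcos_self[OF _ H] by (auto simp: RCOSETS_def)
  have rep: "rep C \<in> C" if "C \<in> ?I" for C
    using that self(2) unfolding rep_def some_in_eq by (auto simp: RCOSETS_def)
  have same: "ginv g s = ginv (rep C) s" if C: "C \<in> ?I" "g \<in> C" and s: "s \<in> fixed_by H" for C g s
  proof -
    from coset[OF C] rep[OF C(1)] obtain h where h: "h \<in> H" "rep C = h \<circ> g" and g: "g \<in> G"
      by (auto simp: r_coset_def G_comp)
    then have "ginv (rep C) s = ginv g (ginv h s)" using HG by (auto simp: ginv_comp)
    moreover have "ginv h s = s" using h(1) s H.m_inv_closed by (auto simp: fixed_by_def)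
    ultimately show ?thesis by simp
  qed
  have T: "T x \<in> fixed_by H" for x
    unfolding fixed_by_def
  proof safe
    fix \<rho> assume \<rho>: "\<rho> \<in> H"
    have "\<rho> (T x) = (\<Sum>h\<in>H. ginv (h \<circ> ginv \<rho>) x)"
      using \<rho> HG unfolding T_def by (subst G_sum) (auto simp: ginv_comp subset_iff)
    also have "\<dots> = T x" unfolding T_def
      by (rule sum.reindex_bij_witness[of _ "\<lambda>h. h \<circ> \<rho>" "\<lambda>h. h \<circ> ginv \<rho>"])
         (use \<rho> HG in \<open>auto simp: G_comp[symmetric] G.m_assoc subset_iff\<close>)
    finally show "\<rho> (T x) = T x" .
  qed
  have sum_coset: "(\<Sum>g\<in>C. ginv g x) = ginv (rep C) (T x)" if C: "C \<in> ?I" for C x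
  proof -
    have a: "rep C \<in> G" "C = (\<lambda>h. h \<circ> rep C) ` H"
      using coset[OF C rep[OF C]] by (auto simp: r_coset_def G_comp)
    have "inj_on (\<lambda>h. h \<circ> rep C) H"
      using G.inj_on_multc[OF a(1)] HG inj_on_subset by (auto simp: G_comp)
    then have "(\<Sum>g\<in>C. ginv g x) = (\<Sum>h\<in>H. ginv (h \<circ> rep C) x)"
      by (subst a(2)) (simp add: sum.reindex)
    also have "\<dots> = (\<Sum>h\<in>H. ginv (rep C) (ginv h x))"
      by (rule sum.cong) (use a(1) HG in \<open>auto simp: ginv_comp subset_iff\<close>)
    also have "\<dots> = ginv (rep C) (T x)"
      using a(1) by (simp add: T_def G_sum)
    finally show ?thesis .
  qed
  have "card ?I \<le> card B"
  proof (rule card_le_of_independent_rows[where M = "\<lambda>C. ginv (rep C)"])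
    fix c assume c: "\<forall>e\<in>B. (\<Sum>C\<in>?I. c C * ginv (rep C) e) = 0"
    \<comment> \<open>The row coefficients are spread over the group as a function constant on
      cosets; summing over one coset produces \<open>ginv (rep C) (T x)\<close>, and
      \<open>T x\<close> expands in \<open>B\<close>.\<close>
    have "(\<Sum>\<tau>\<in>G. c (H #>\<^bsub>galois_group \<iota>\<^esub> ginv \<tau>) * \<tau> x) = 0" for x
    proof -
      have x: "T x \<in> L.span B" using T B(3) by auto
      have "(\<Sum>\<tau>\<in>G. c (H #>\<^bsub>galois_group \<iota>\<^esub> ginv \<tau>) * \<tau> x)
          = (\<Sum>g\<in>G. c (H #>\<^bsub>galois_group \<iota>\<^esub> g) * ginv g x)"
        by (subst sum_G_ginv[symmetric]) simp
      also have "\<dots> = (\<Sum>C\<in>?I. \<Sum>g\<in>C. c (H #>\<^bsub>galois_group \<iota>\<^esub> g) * ginv g x)"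
        unfolding G.rcosets_part_G[OF H, symmetric]
        by (subst sum.Union_disjoint)
           (use finite_subset[OF H.rcosets_carrier[OF G.is_group] finite_G] G.rcos_disjoint[OF H]
              in \<open>auto simp: pairwise_def disjnt_def\<close>)
      also have "\<dots> = (\<Sum>C\<in>?I. c C * ginv (rep C) (T x))"
        by (rule sum.cong[OF refl], subst sum_coset[symmetric])
           (use coset in \<open>auto simp: sum_distrib_left intro!: sum.cong\<close>)
      also have "\<dots> = (\<Sum>C\<in>?I. \<Sum>e\<in>B. \<iota> (L.representation B (T x) e) * (c C * ginv (rep C) e))"
      proof (rule sum.cong[OF refl])
        fix C assume "C \<in> ?I"
        then have "ginv (rep C) \<in> G" using coset(2)[OF _ rep] by auto
        from G_basis[OF finB B(2) x this]
        show "c C * ginv (rep C) (T x)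
          = (\<Sum>e\<in>B. \<iota> (L.representation B (T x) e) * (c C * ginv (rep C) e))"
          by (simp add: sum_distrib_left mult.left_commute)
      qed
      also have "\<dots> = (\<Sum>e\<in>B. \<iota> (L.representation B (T x) e) * (\<Sum>C\<in>?I. c C * ginv (rep C) e))"
        by (subst sum.swap) (simp add: sum_distrib_left)
      finally show ?thesis using c by simp
    qed
    then have z: "c (H #>\<^bsub>galois_group \<iota>\<^esub> ginv \<tau>) = 0" if "\<tau> \<in> G" for \<tau>
      using G_independent[OF finite_G order_refl _ that,
          of "\<lambda>\<tau>. c (H #>\<^bsub>galois_group \<iota>\<^esub> ginv \<tau>)"] by blast
    show "\<forall>C\<in>?I. c C = 0"
    proof
      fix C assume C: "C \<in> ?I"
      show "c C = 0" using z[of "ginv (rep C)"] coset[OF C rep[OF C]] by simp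
    qed
  qed (use finB finI in auto)
  moreover have "card B \<le> card ?I"
  proof (rule card_le_of_independent_rows[where M = "\<lambda>e C. ginv (rep C) e"])
    fix a assume a: "\<forall>C\<in>?I. (\<Sum>e\<in>B. a e * ginv (rep C) e) = 0"
    have "tr (a e * u) = 0" if "e \<in> B" for e u
    proof (rule basis_coeff_eq_0[OF finB B(2) _ that])
      have "(\<Sum>e\<in>B. \<tau> (a e * u) * e) = 0" if t: "\<tau> \<in> G" for \<tau>
      proof -
        have "(\<Sum>e\<in>B. a e * ginv \<tau> e)
            = (\<Sum>e\<in>B. a e * ginv (rep (H #>\<^bsub>galois_group \<iota>\<^esub> \<tau>)) e)"
          by (rule sum.cong[OF refl]) (use same[OF self[OF t]] B(1) in auto)
        also have "\<dots> = 0" using a self(1)[OF t] by blast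
        finally have "(\<Sum>e\<in>B. a e * ginv \<tau> e) = 0" .
        \<comment> \<open>Applying \<open>\<tau>\<close> restores \<open>e\<close> itself, so after
          summing over all \<open>\<tau>\<close> the coefficient of \<open>e\<close> is the trace of
          \<open>a e * u\<close>, an element of \<open>K\<close>.\<close>
        then have "\<tau> (u * (\<Sum>e\<in>B. a e * ginv \<tau> e)) = 0" using t by (simp add: G_zero)
        then show ?thesis using t
          by (simp add: sum_distrib_left G_sum G_mult G_ginv mult_ac)
      qed
      then have "(\<Sum>\<tau>\<in>G. \<Sum>e\<in>B. \<tau> (a e * u) * e) = 0" by simp
      then show "(\<Sum>e\<in>B. \<iota> (tr (a e * u)) * e) = 0"
        by (subst (asm) sum.swap) (simp add: emb_tr sum_distrib_right)
    qed
    then show "\<forall>e\<in>B. a e = 0" using tr_nondegenerate by blast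
  qed (use finB finI in auto)
  ultimately show ?thesis using B(4) by simp
qed

text \<open>The trivial subgroup fixes all of \<open>L\<close>, so the degree is the number of its
  cosets; Lagrange's theorem compares this with the index of \<open>H\<close>.\<close>

lemma dim_fixed_by:
  assumes "subgroup H (galois_group \<iota>)"
  shows "L.dim (fixed_by H) * card H = ext_degree \<iota>"
proof -
  have triv: "subgroup {id} (galois_group \<iota>)"
    using G.triv_subgroup by (simp add: G_one)
  have "card (rcosets\<^bsub>galois_group \<iota>\<^esub> H) * card H = card (rcosets\<^bsub>galois_group \<iota>\<^esub> {id})"
    using G.lagrange[OF assms] G.lagrange[OF triv] by simp
  moreover have "fixed_by {id} = UNIV" by (auto simp: fixed_by_def)
  ultimately show ?thesis
    using dim_fixed_by_eq_card_rcosets[OF assms] dim_fixed_by_eq_card_rcosets[OF triv]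
    by (simp add: ext_degree_def)
qed

lemma dim_image_klinear:
  assumes "vector_space scale" "klinear scale f" "inj_on f S" "L.subspace S"
  shows "vector_space.dim scale (f ` S) = L.dim S"
proof -
  interpret W: vector_space scale by fact
  obtain B where B: "finite B" "L.independent B" "L.span B = UNIV" by (rule obtain_basis)
  interpret finite_dimensional_vector_space_pair_1 "ext_scale \<iota>" B scale
    by unfold_locales (use B in auto)
  show ?thesis using assms by (intro dim_image_eq) (simp_all add: L.span_eq_iff[THEN iffD2])
qed

subsection \<open>The forms attached to one automorphism\<close>

text \<open>Invariance of the trace moves the automorphism off \<open>y\<close>. The form then reads
  \<open>tr (F x * y)\<close> with \<open>F\<close> a combination of \<open>\<sigma>\<close> and its
  inverse, ready for nondegeneracy and independence.\<close>

lemma galois_form_eq: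
  assumes "\<sigma> \<in> G"
  shows "galois_form \<iota> b \<sigma> x y = tr ((ginv \<sigma> (b * x) - b * \<sigma> x) * y)"
proof -
  have "tr (b * x * \<sigma> y) = tr (ginv \<sigma> (b * x * \<sigma> y))" using assms by (simp add: tr_G)
  also have "\<dots> = tr (ginv \<sigma> (b * x) * y)" using assms by (simp add: G_mult ginv_G)
  finally show ?thesis
    by (simp add: galois_form_def right_diff_distrib left_diff_distrib tr_diff mult.assoc)
qed

lemma galois_forms_eq_range: "galois_forms \<iota> \<sigma> = range (\<lambda>b. galois_form \<iota> b \<sigma>)"
  by (auto simp: galois_forms_def)

lemma klinear_galois_form: "klinear form_scale (\<lambda>b. galois_form \<iota> b \<sigma>)"
  unfolding Vector_Spaces.linear_iff
proof (intro conjI allI L.vector_space_axioms forms.vector_space_axioms)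
  show "galois_form \<iota> (b + b') \<sigma> = galois_form \<iota> b \<sigma> + galois_form \<iota> b' \<sigma>" for b b'
    by (simp add: galois_form_def fun_eq_iff distrib_right tr_add)
  show "galois_form \<iota> (ext_scale \<iota> a b) \<sigma> = form_scale a (galois_form \<iota> b \<sigma>)" for a b
    by (simp add: galois_form_def form_scale_def ext_scale_def mult.assoc tr_scale)
qed

lemma subspace_galois_forms: "forms.subspace (galois_forms \<iota> \<sigma>)"
proof -
  interpret f: Vector_Spaces.linear "ext_scale \<iota>" form_scale "\<lambda>b. galois_form \<iota> b \<sigma>"
    by (rule klinear_galois_form)
  show ?thesis unfolding galois_forms_eq_range by (rule f.subspace_image) simp
qed

lemma subspace_alternating_forms: "forms.subspace (alternating_forms \<iota>)"
proof -
  have zero: "klinear (*) (\<lambda>x. 0)" unfolding klinear_iff by simp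
  have add: "klinear (*) (\<lambda>x. u x + v x)" if "klinear (*) u" "klinear (*) v" for u v
    using that unfolding klinear_iff by (simp add: distrib_left add.assoc add.left_commute)
  have scale: "klinear (*) (\<lambda>x. c * u x)" if "klinear (*) u" for c u
    using that unfolding klinear_iff by (simp add: distrib_left mult.left_commute)
  show ?thesis
    by (auto simp: forms.subspace_def alternating_forms_def form_scale_def plus_fun_def zero_fun_def
        intro: zero add scale)
qed

lemma galois_forms_subset_alternating:
  assumes "\<sigma> \<in> G"
  shows "galois_forms \<iota> \<sigma> \<subseteq> alternating_forms \<iota>"
proof -
  have "tr (b * ((x + x') * \<sigma> y - \<sigma> (x + x') * y))
      = tr (b * (x * \<sigma> y - \<sigma> x * y)) + tr (b * (x' * \<sigma> y - \<sigma> x' * y))"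
    "tr (b * (y * \<sigma> (x + x') - \<sigma> y * (x + x')))
      = tr (b * (y * \<sigma> x - \<sigma> y * x)) + tr (b * (y * \<sigma> x' - \<sigma> y * x'))"
    "tr (b * (\<iota> a * x * \<sigma> y - \<sigma> (\<iota> a * x) * y)) = a * tr (b * (x * \<sigma> y - \<sigma> x * y))"
    "tr (b * (y * \<sigma> (\<iota> a * x) - \<sigma> y * (\<iota> a * x))) = a * tr (b * (y * \<sigma> x - \<sigma> y * x))" for a b x x' y
    unfolding tr_add[symmetric] tr_scale[symmetric]
    using assms by (simp_all add: G_add G_mult G_emb algebra_simps)
  then show ?thesis
    by (auto simp: galois_forms_def alternating_forms_def galois_form_def klinear_iff
        mult.commute tr_zero)
qed

text \<open>The coefficients of \<open>\<sigma>\<close> and of its inverse are \<open>- b\<close>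
  and \<open>ginv \<sigma> b\<close>, and independence kills both. For an involution they would
  merge into \<open>\<sigma> b - b\<close>, which can vanish for nonzero \<open>b\<close>.\<close>

lemma galois_form_eq_0D:
  assumes "\<sigma> \<in> G" "ginv \<sigma> \<noteq> \<sigma>" "galois_form \<iota> b \<sigma> = 0"
  shows "b = 0"
proof -
  have "ginv \<sigma> (b * x) - b * \<sigma> x = 0" for x
    using assms by (intro tr_nondegenerate) (simp flip: galois_form_eq)
  then have "(\<Sum>\<tau>\<in>{\<sigma>, ginv \<sigma>}. (if \<tau> = \<sigma> then - b else ginv \<sigma> b) * \<tau> x) = 0" for x
    using assms(1,2) by (simp add: G_mult)
  from G_independent[OF _ _ this, of \<sigma>] assms(1) show ?thesis by simp
qed

lemma dim_galois_forms:
  assumes "\<sigma> \<in> G" "ginv \<sigma> \<noteq> \<sigma>"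
  shows "forms.dim (galois_forms \<iota> \<sigma>) = ext_degree \<iota>"
proof -
  interpret f: Vector_Spaces.linear "ext_scale \<iota>" form_scale "\<lambda>b. galois_form \<iota> b \<sigma>"
    by (rule klinear_galois_form)
  have "inj (\<lambda>b. galois_form \<iota> b \<sigma>)"
    using galois_form_eq_0D[OF assms] by (auto simp: f.inj_iff_eq_0)
  then show ?thesis
    using dim_image_klinear[OF vector_space_form_scale klinear_galois_form]
    by (simp add: galois_forms_eq_range ext_degree_def)
qed

section \<open>Radical and rank of a single form\<close>

lemma G_inverse: "\<tau> \<in> G \<Longrightarrow> \<tau> (inverse x) = inverse (\<tau> x)"
  by (metis G_mult G_unit G_zero inverse_unique inverse_zero right_inverse)

lemma mem_radical_galois_form:
  assumes "\<sigma> \<in> G"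
  shows "x \<in> form_radical (galois_form \<iota> b \<sigma>) \<longleftrightarrow> b * x = \<sigma> b * \<sigma> (\<sigma> x)"
proof -
  have "x \<in> form_radical (galois_form \<iota> b \<sigma>) \<longleftrightarrow> ginv \<sigma> (b * x) - b * \<sigma> x = 0"
    unfolding form_radical_def using assms tr_nondegenerate[of "ginv \<sigma> (b * x) - b * \<sigma> x"]
    by (auto simp: galois_form_eq tr_zero)
  also have "\<dots> \<longleftrightarrow> b * x = \<sigma> (b * \<sigma> x)"
    using assms by (metis G_ginv ginv_G right_minus_eq)
  finally show ?thesis using assms by (simp add: G_mult)
qed

lemma funpow_eq_pow: "\<sigma> ^^ k = \<sigma> [^]\<^bsub>galois_group \<iota>\<^esub> k"
  by (induction k) (simp_all add: G_one G_comp funpow_Suc_right del: funpow.simps(2))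

lemma funpow_in_G: "\<sigma> \<in> G \<Longrightarrow> \<sigma> ^^ k \<in> G"
  unfolding funpow_eq_pow by simp

lemma fixed_by_generate:
  assumes "\<sigma> \<in> G" "G.ord \<sigma> \<noteq> 0"
  shows "fixed_by (generate (galois_group \<iota>) {\<sigma>}) = {x. \<sigma> x = x}"
proof -
  have "(\<sigma> ^^ k) x = x" if "\<sigma> x = x" for k x
    using that by (induction k) auto
  moreover have "\<sigma> \<in> generate (galois_group \<iota>) {\<sigma>}" by (simp add: generate.incl)
  ultimately show ?thesis
    unfolding fixed_by_def using G.generate_pow_nat[OF assms] by (auto simp flip: funpow_eq_pow)
qed

text \<open>The element \<open>inverse P\<close> is a nonzero solution of the radical equation, and
  the quotient of any solution by it is fixed by \<open>\<sigma> \<circ> \<sigma>\<close>. So the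
  radical is a multiple of the fixed field of \<open>\<sigma>\<close>, whose dimension comes from
  the order of the cyclic group generated by \<open>\<sigma>\<close>.\<close>

lemma dim_radical_galois_form:
  assumes \<sigma>: "\<sigma> \<in> G" and ord: "G.ord \<sigma> = 2 * r + 1" and b: "b \<noteq> 0"
  shows "L.dim (form_radical (galois_form \<iota> b \<sigma>)) * (2 * r + 1) = ext_degree \<iota>"
proof -
  let ?S = "{x. \<sigma> x = x}"
  have period: "\<sigma> ((\<sigma> ^^ (2 * r)) x) = x" for x
  proof -
    have "\<sigma> ^^ (2 * r + 1) = id"
      using G.pow_ord_eq_1[OF \<sigma>] unfolding ord funpow_eq_pow G_one .
    then show ?thesis by (simp add: fun_eq_iff)
  qed
  define P where "P = (\<Prod>k\<le>r. (\<sigma> ^^ (2 * k)) b)"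
  have P: "P \<noteq> 0" using b \<sigma> by (auto simp: P_def G_eq_0_iff funpow_in_G)
  \<comment> \<open>As \<open>\<sigma> = (\<sigma> \<circ> \<sigma>) ^^ (r + 1)\<close>, the quotient of \<open>b\<close> by \<open>\<sigma> b\<close> telescopes.\<close>
  have "b * \<sigma> (\<sigma> P) = (\<Prod>k\<le>Suc r. (\<sigma> ^^ (2 * k)) b)"
    unfolding P_def prod.atMost_Suc_shift using \<sigma> by (simp add: G_prod)
  \<comment> \<open>The top factor has exponent \<open>2 * r + 2\<close>, one more than the period,
    so it equals \<open>\<sigma> b\<close>.\<close>
  also have "\<dots> = P * \<sigma> b"
    by (simp add: P_def period)
  finally have x0: "b * inverse P = \<sigma> b * \<sigma> (\<sigma> (inverse P))"
    using P \<sigma> by (simp add: G_inverse G_eq_0_iff nonzero_divide_eq_eq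
        nonzero_eq_divide_eq mult_ac flip: divide_inverse)
  have "form_radical (galois_form \<iota> b \<sigma>) = (*) (inverse P) ` ?S"
  proof (intro subset_antisym subsetI)
    fix x assume "x \<in> form_radical (galois_form \<iota> b \<sigma>)"
    then have x: "b * x = \<sigma> b * \<sigma> (\<sigma> x)" using \<sigma> by (simp add: mem_radical_galois_form)
    define s where "s = P * x"
    have xs: "x = inverse P * s" using P by (simp add: s_def)
    have "b * inverse P * s = \<sigma> b * \<sigma> (\<sigma> (inverse P * s))"
      using x by (simp add: xs mult.assoc)
    also have "\<dots> = \<sigma> b * \<sigma> (\<sigma> (inverse P)) * \<sigma> (\<sigma> s)"
      using \<sigma> by (simp add: G_mult mult.assoc)
    also have "\<dots> = b * inverse P * \<sigma> (\<sigma> s)"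
      by (simp only: x0)
    finally have s: "\<sigma> (\<sigma> s) = s" using b P by simp
    \<comment> \<open>Odd order enters here: the even power \<open>2 * r\<close> fixes
      \<open>s\<close>, and one further application of \<open>\<sigma>\<close> completes the
      period.\<close>
    have "(\<sigma> ^^ (2 * k)) s = s" for k by (induction k) (simp_all add: s)
    then have "\<sigma> s = s" using period[of s] by simp
    then show "x \<in> (*) (inverse P) ` ?S" using xs by blast
  next
    fix x assume "x \<in> (*) (inverse P) ` ?S"
    then show "x \<in> form_radical (galois_form \<iota> b \<sigma>)"
      using \<sigma> x0 by (auto simp: mem_radical_galois_form G_mult mult.assoc[symmetric])
  qed
  moreover have "L.dim ((*) (inverse P) ` ?S) = L.dim ?S"
  proof (rule dim_image_klinear[OF L.vector_space_axioms])
    show "klinear (ext_scale \<iota>) ((*) (inverse P))"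
      by (auto simp: Vector_Spaces.linear_iff L.vector_space_axioms ext_scale_def algebra_simps)
    show "L.subspace ?S"
      using subspace_fixed_by[of "{\<sigma>}"] \<sigma> by (simp add: fixed_by_def)
    show "inj_on ((*) (inverse P)) ?S" using P by (auto simp: inj_on_def)
  qed
  moreover have "L.dim ?S * (2 * r + 1) = ext_degree \<iota>"
    using dim_fixed_by[OF G.generate_is_subgroup[of "{\<sigma>}"]] fixed_by_generate[OF \<sigma>]
      G.generate_pow_card[OF \<sigma>] ord \<sigma> by simp
  ultimately show ?thesis by simp
qed

lemma rank_galois_form:
  assumes "\<sigma> \<in> G" "G.ord \<sigma> = 2 * r + 1" "f \<in> galois_forms \<iota> \<sigma>" "f \<noteq> 0"
  shows "real (form_rank \<iota> f) = real (ext_degree \<iota>) - real (ext_degree \<iota>) / real (2 * r + 1)"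
proof -
  obtain b where f: "f = galois_form \<iota> b \<sigma>" using assms(3) by (auto simp: galois_forms_def)
  have "b \<noteq> 0" using assms(4) unfolding f by (auto simp: galois_form_def tr_zero fun_eq_iff)
  from dim_radical_galois_form[OF assms(1,2) this]
  have d: "ext_degree \<iota> = L.dim (form_radical f) * (2 * r + 1)" by (simp add: f)
  then have "real (ext_degree \<iota>) = real (L.dim (form_radical f)) * real (2 * r + 1)"
    by (metis of_nat_mult)
  then have "real (ext_degree \<iota>) / real (2 * r + 1) = real (L.dim (form_radical f))"
    by (simp add: field_simps)
  \<comment> \<open>The rank is a truncated difference of naturals; this bound makes it agree with
    the real one.\<close>
  moreover have "L.dim (form_radical f) \<le> ext_degree \<iota>" using d by simp
  ultimately show ?thesis by (simp add: form_rank_def of_nat_diff)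
qed


subsection \<open>The decomposition\<close>

lemma sum_forms_apply: "(\<Sum>i\<in>I. f i) x y = (\<Sum>i\<in>I. f i x y)"
  for f :: "'i \<Rightarrow> 'l \<Rightarrow> 'l \<Rightarrow> 'k"
  by (induction I rule: infinite_finite_induct) simp_all

text \<open>Representing each functional \<open>f x\<close> by the trace gives a linear map
  \<open>F\<close>. Skew symmetry says that \<open>F\<close> is minus its adjoint for the trace
  form, and independence allows comparing coefficients.\<close>

lemma alternating_form_expansion:
  assumes f: "f \<in> alternating_forms \<iota>"
  obtains c where "\<And>x y. f x y = tr ((\<Sum>\<tau>\<in>G. c \<tau> * \<tau> x) * y)"
    and "\<And>\<tau>. \<tau> \<in> G \<Longrightarrow> c \<tau> = - \<tau> (c (ginv \<tau>))"
proof -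
  have lin: "klinear (*) (f x)" "klinear (*) (\<lambda>x. f x y)" and zero: "f x x = 0" for x y
    using f by (auto simp: alternating_forms_def)
  have "\<exists>b. \<forall>y. f x y = tr (b * y)" for x
    using lin(1) by (rule functional_eq_tr) blast
  then obtain F where F: "\<And>x y. f x y = tr (F x * y)" by metis
  have "klinear (ext_scale \<iota>) F"
    unfolding Vector_Spaces.linear_iff
  proof (intro conjI allI L.vector_space_axioms)
    show "F (x + x') = F x + F x'" for x x'
      using lin(2) by (intro tr_eqI) (simp add: distrib_right tr_add klinear_iff flip: F)
    show "F (ext_scale \<iota> a x) = ext_scale \<iota> a (F x)" for a x
      using lin(2) by (intro tr_eqI) (simp add: ext_scale_def mult.assoc tr_scale klinear_iff flip: F)
  qed
  then obtain c where c: "\<And>x. F x = (\<Sum>\<tau>\<in>G. c \<tau> * \<tau> x)" by (rule klinear_expansion) blast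
  have skew: "f x y = - f y x" for x y
  proof -
    have "f (x + y) (x + y) = f x x + f x y + (f y x + f y y)"
      using lin unfolding klinear_iff by simp
    then show ?thesis by (simp add: zero eq_neg_iff_add_eq_0)
  qed
  have adj: "F x = - (\<Sum>\<tau>\<in>G. \<tau> (c (ginv \<tau>)) * \<tau> x)" for x
  proof (rule tr_eqI)
    fix y
    have "tr (F x * y) = - tr (\<Sum>\<tau>\<in>G. c \<tau> * \<tau> y * x)"
      using skew[of x y] by (simp add: F c sum_distrib_right)
    also have "tr (\<Sum>\<tau>\<in>G. c \<tau> * \<tau> y * x) = tr (\<Sum>\<tau>\<in>G. ginv \<tau> (c \<tau>) * ginv \<tau> x * y)"
      unfolding tr_sum
    proof (rule sum.cong[OF refl])
      fix \<tau> assume "\<tau> \<in> G"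
      then show "tr (c \<tau> * \<tau> y * x) = tr (ginv \<tau> (c \<tau>) * ginv \<tau> x * y)"
        using tr_G[of "ginv \<tau>" "c \<tau> * \<tau> y * x"] by (simp add: G_mult ginv_G mult_ac)
    qed
    also have "\<dots> = tr (\<Sum>\<tau>\<in>G. \<tau> (c (ginv \<tau>)) * \<tau> x * y)"
      by (subst (2) sum_G_ginv[symmetric]) simp
    finally show "tr (F x * y) = tr (- (\<Sum>\<tau>\<in>G. \<tau> (c (ginv \<tau>)) * \<tau> x) * y)"
      by (simp add: tr_minus sum_distrib_right)
  qed
  have "c \<tau> = - \<tau> (c (ginv \<tau>))" if "\<tau> \<in> G" for \<tau>
  proof -
    have "(\<Sum>\<tau>\<in>G. (c \<tau> + \<tau> (c (ginv \<tau>))) * \<tau> x) = 0" for x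
      using adj[of x] by (simp add: c distrib_right sum.distrib)
    from G_independent[OF finite_G order_refl this that] show ?thesis
      by (simp add: eq_neg_iff_add_eq_0)
  qed
  moreover have "f x y = tr ((\<Sum>\<tau>\<in>G. c \<tau> * \<tau> x) * y)" for x y
    by (simp only: F c)
  ultimately show ?thesis using that by blast
qed

text \<open>Polarization would lose information in characteristic 2. Squares of automorphisms are
  multiplicative in every characteristic, so it suffices that distinct automorphisms have distinct
  squares.\<close>

lemma tr_square_eq_0D:
  assumes "\<And>x. tr (b * (x * x)) = 0"
  shows "b = 0"
proof -
  have "\<rho> x = \<tau> x" if G: "\<rho> \<in> G" "\<tau> \<in> G" and sq: "\<And>z. \<rho> z * \<rho> z = \<tau> z * \<tau> z" for \<rho> \<tau> x
  proof -
    \<comment> \<open>Comparing squares at \<open>x + 1\<close> and at \<open>x\<close> shows that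
      the doubles of \<open>\<rho> x\<close> and \<open>\<tau> x\<close> agree. Then the square of
      their difference vanishes, with no division by 2.\<close>
    have "(\<rho> x + 1) * (\<rho> x + 1) = (\<tau> x + 1) * (\<tau> x + 1)"
      using sq[of "x + 1"] by (simp only: G_add[OF G(1)] G_add[OF G(2)] G_unit[OF G(1)] G_unit[OF G(2)])
    moreover have "(u + 1) * (u + 1) = u * u + (u + u) + 1" for u :: 'l
      by (simp add: algebra_simps)
    ultimately have "\<rho> x * \<rho> x + (\<rho> x + \<rho> x) = \<tau> x * \<tau> x + (\<tau> x + \<tau> x)"
      by (metis add_right_cancel)
    then have two: "\<rho> x + \<rho> x = \<tau> x + \<tau> x"
      unfolding sq[of x] by (rule add_left_imp_eq)
    have "(u - v) * (u - v) = u * u - (u + u) * v + v * v" for u v :: 'l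
      by (simp add: algebra_simps)
    from this[of "\<rho> x" "\<tau> x"] have "(\<rho> x - \<tau> x) * (\<rho> x - \<tau> x) = 0"
      unfolding two sq[of x] by (simp add: distrib_right)
    then show "\<rho> x = \<tau> x" by simp
  qed
  then have "inj_on (\<lambda>\<tau> x. \<tau> x * \<tau> x) G"
    unfolding inj_on_def fun_eq_iff by blast
  moreover have "(\<Sum>\<tau>\<in>G. \<tau> b * (\<tau> x * \<tau> x)) = 0" for x
    using emb_tr[of "b * (x * x)"] assms by (simp add: G_mult emb_zero)
  ultimately have "\<forall>\<tau>\<in>G. \<tau> b = 0"
    by (intro dedekind_independence[where \<chi> = "\<lambda>\<tau> x. \<tau> x * \<tau> x", OF finite_G])
       (auto simp: G_mult G_unit mult_ac)
  then have "one (galois_group \<iota>) b = 0" by blast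
  then show ?thesis by (simp add: G_one)
qed

text \<open>A pair \<open>(i, s)\<close> chooses between \<open>\<sigma> i\<close> and its inverse.
  The enumeration thus becomes one bijection, which reindexes sums and supplies a single injective
  family of characters.\<close>

context
  fixes I :: "'i set" and \<sigma> :: "'i \<Rightarrow> 'l \<Rightarrow> 'l" and \<chi> :: "'i \<times> bool \<Rightarrow> 'l \<Rightarrow> 'l"
  assumes finite_I: "finite I"
    and \<chi>: "\<And>i s. \<chi> (i, s) = (if s then \<sigma> i else ginv (\<sigma> i))"
    and bij: "bij_betw \<chi> (I \<times> UNIV) (G - {id})"
begin

lemma enum_in_G: "i \<in> I \<Longrightarrow> \<sigma> i \<in> G"
  using bij_betwE[OF bij] by (metis DiffD1 SigmaI UNIV_I \<chi>)

lemma sum_G_enum: "(\<Sum>\<tau>\<in>G. F \<tau>) = F id + (\<Sum>i\<in>I. F (\<sigma> i) + F (ginv (\<sigma> i)))"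
proof -
  have "(\<Sum>\<tau>\<in>G. F \<tau>) = F id + (\<Sum>\<tau>\<in>G - {id}. F \<tau>)"
    using finite_G G.one_closed by (intro sum.remove) (simp_all add: G_one)
  also have "(\<Sum>\<tau>\<in>G - {id}. F \<tau>) = (\<Sum>p\<in>I \<times> UNIV. F (\<chi> p))"
    by (rule sum.reindex_bij_betw[OF bij, symmetric])
  also have "\<dots> = (\<Sum>i\<in>I. \<Sum>s\<in>UNIV. F (\<chi> (i, s)))"
    by (simp add: sum.cartesian_product)
  also have "\<dots> = (\<Sum>i\<in>I. F (\<sigma> i) + F (ginv (\<sigma> i)))"
    by (simp add: UNIV_bool \<chi> add.commute)
  finally show ?thesis .
qed

lemma alternating_form_eq_sum:
  assumes f: "f \<in> alternating_forms \<iota>"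
  obtains b where "f = (\<Sum>i\<in>I. galois_form \<iota> (b i) (\<sigma> i))"
proof -
  obtain c where fc: "\<And>x y. f x y = tr ((\<Sum>\<tau>\<in>G. c \<tau> * \<tau> x) * y)"
    and c: "\<And>\<tau>. \<tau> \<in> G \<Longrightarrow> c \<tau> = - \<tau> (c (ginv \<tau>))"
    by (rule alternating_form_expansion[OF f]) blast
  \<comment> \<open>In \<open>galois_form_eq\<close> the coefficient of \<open>\<sigma>\<close> is
    \<open>- b\<close>, hence the choice \<open>b = - c (\<sigma> i)\<close>; skew symmetry makes
    the coefficient of the inverse match as well.\<close>
  have *: "f x y = tr (c id * x * y) + (\<Sum>i\<in>I. galois_form \<iota> (- c (\<sigma> i)) (\<sigma> i) x y)" for x y
  proof -
    have "c (\<sigma> i) * \<sigma> i x + c (ginv (\<sigma> i)) * ginv (\<sigma> i) x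
        = ginv (\<sigma> i) (- c (\<sigma> i) * x) - - c (\<sigma> i) * \<sigma> i x" if "i \<in> I" for i
    proof -
      have "c (ginv (\<sigma> i)) = - ginv (\<sigma> i) (c (\<sigma> i))"
        using c[of "ginv (\<sigma> i)"] enum_in_G[OF that] by simp
      then show ?thesis using enum_in_G[OF that] by (simp add: G_mult G_minus)
    qed
    then have "(\<Sum>\<tau>\<in>G. c \<tau> * \<tau> x)
        = c id * x + (\<Sum>i\<in>I. ginv (\<sigma> i) (- c (\<sigma> i) * x) - - c (\<sigma> i) * \<sigma> i x)"
      unfolding sum_G_enum by (simp add: add.commute)
    then have f_eq: "f x y = tr (c id * x * y)
        + (\<Sum>i\<in>I. tr ((ginv (\<sigma> i) (- c (\<sigma> i) * x) - - c (\<sigma> i) * \<sigma> i x) * y))"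
      by (simp only: fc distrib_right sum_distrib_right tr_add tr_sum)
    show ?thesis
      unfolding f_eq by (intro arg_cong2[where f = "(+)"] refl sum.cong)
        (rule galois_form_eq[OF enum_in_G, symmetric])
  qed
  \<comment> \<open>On the diagonal all other summands vanish, leaving the trace of
    \<open>c id * (x * x)\<close>.\<close>
  have "c id = 0"
  proof (rule tr_square_eq_0D)
    fix x
    have "galois_form \<iota> b (\<sigma> i) x x = 0" for b i
      by (simp add: galois_form_def mult.commute tr_zero)
    moreover have "f x x = 0" using f by (simp add: alternating_forms_def)
    ultimately show "tr (c id * (x * x)) = 0" using *[of x x] by (simp add: mult.assoc)
  qed
  then have "f = (\<Sum>i\<in>I. galois_form \<iota> (- c (\<sigma> i)) (\<sigma> i))"
    by (intro ext) (simp add: * sum_forms_apply tr_zero)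
  then show ?thesis by (rule that)
qed

text \<open>By nondegeneracy a vanishing sum is a relation among the characters
  \<open>\<chi> p\<close>, which are pairwise distinct; the coefficient at \<open>(i, True)\<close>
  is \<open>- d i\<close>.\<close>

lemma galois_form_sum_eq_0D:
  assumes "(\<Sum>i\<in>I. galois_form \<iota> (d i) (\<sigma> i)) = 0" "i \<in> I"
  shows "d i = 0"
proof -
  define c where "c p = (if snd p then - d (fst p) else ginv (\<sigma> (fst p)) (d (fst p)))" for p :: "'i \<times> bool"
  have "(\<Sum>p\<in>I \<times> UNIV. c p * \<chi> p x) = 0" for x
  proof (rule tr_nondegenerate)
    fix y
    have "(\<Sum>p\<in>I \<times> UNIV. c p * \<chi> p x) = (\<Sum>i\<in>I. \<Sum>s\<in>UNIV. c (i, s) * \<chi> (i, s) x)"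
      by (simp add: sum.cartesian_product)
    also have "\<dots> = (\<Sum>i\<in>I. ginv (\<sigma> i) (d i * x) - d i * \<sigma> i x)"
      by (rule sum.cong[OF refl]) (use enum_in_G in \<open>simp add: UNIV_bool c_def \<chi> G_mult\<close>)
    finally have "tr ((\<Sum>p\<in>I \<times> UNIV. c p * \<chi> p x) * y) = (\<Sum>i\<in>I. galois_form \<iota> (d i) (\<sigma> i)) x y"
      using enum_in_G by (simp add: sum_distrib_right tr_sum galois_form_eq sum_forms_apply)
    then show "tr ((\<Sum>p\<in>I \<times> UNIV. c p * \<chi> p x) * y) = 0" by (simp add: assms(1))
  qed
  moreover have "\<chi> p \<in> G" if "p \<in> I \<times> UNIV" for p
    using bij_betwE[OF bij] that by auto
  ultimately have "\<forall>p\<in>I \<times> UNIV. c p = 0"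
    using finite_I bij by (intro dedekind_independence[where \<chi> = \<chi>])
      (auto simp: G_mult G_unit bij_betw_def)
  then have "c (i, True) = 0" using assms(2) by blast
  then show ?thesis by (simp add: c_def)
qed

lemma alternating_forms_direct_sum:
  "is_direct_sum form_scale (alternating_forms \<iota>) I (\<lambda>i. galois_forms \<iota> (\<sigma> i))"
  unfolding is_direct_sum_def
proof (intro conjI ballI allI impI)
  fix i assume "i \<in> I"
  show "forms.subspace (galois_forms \<iota> (\<sigma> i))" by (rule subspace_galois_forms)
next
  have "(\<Sum>i\<in>I. g i) \<in> alternating_forms \<iota>" if "\<forall>i\<in>I. g i \<in> galois_forms \<iota> (\<sigma> i)" for g
    using that galois_forms_subset_alternating[OF enum_in_G]
    by (intro forms.subspace_sum[OF subspace_alternating_forms]) blast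
  moreover have "\<exists>g. f = (\<Sum>i\<in>I. g i) \<and> (\<forall>i\<in>I. g i \<in> galois_forms \<iota> (\<sigma> i))"
    if f: "f \<in> alternating_forms \<iota>" for f
  proof -
    obtain b where "f = (\<Sum>i\<in>I. galois_form \<iota> (b i) (\<sigma> i))"
      by (rule alternating_form_eq_sum[OF f])
    then show ?thesis
      by (intro exI[of _ "\<lambda>i. galois_form \<iota> (b i) (\<sigma> i)"]) (auto simp: galois_forms_def)
  qed
  ultimately show "{\<Sum>i\<in>I. g i |g. \<forall>i\<in>I. g i \<in> galois_forms \<iota> (\<sigma> i)} = alternating_forms \<iota>"
    by blast
next
  fix g h i
  assume gh: "(\<forall>i\<in>I. g i \<in> galois_forms \<iota> (\<sigma> i) \<and> h i \<in> galois_forms \<iota> (\<sigma> i)) \<and>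
      (\<Sum>i\<in>I. g i) = (\<Sum>i\<in>I. h i)" and i: "i \<in> I"
  have "\<forall>i\<in>I. \<exists>b. g i - h i = galois_form \<iota> b (\<sigma> i)"
    using gh forms.subspace_diff[OF subspace_galois_forms] by (force simp: galois_forms_def)
  then obtain d where d: "\<And>i. i \<in> I \<Longrightarrow> g i - h i = galois_form \<iota> (d i) (\<sigma> i)" by metis
  have "(\<Sum>i\<in>I. galois_form \<iota> (d i) (\<sigma> i)) = (\<Sum>i\<in>I. g i - h i)"
    by (rule sum.cong) (simp_all add: d)
  also have "\<dots> = 0" using gh by (simp add: sum_subtractf)
  finally have "d i = 0" using i by (rule galois_form_sum_eq_0D)
  then have "g i - h i = 0" using d[OF i] by (simp add: galois_form_def tr_zero fun_eq_iff)
  then show "g i = h i" by simp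
qed

end

end

theorem corollary3:
  fixes \<iota> :: "'k::field \<Rightarrow> 'l::field" and n m :: nat and \<sigma> :: "nat \<Rightarrow> 'l \<Rightarrow> 'l"
  defines "G \<equiv> galois_group \<iota>"
  assumes galois: "finite_galois_extension \<iota>"
    and degree: "n = ext_degree \<iota>" and "odd n" and "m = (n - 1) div 2"
    and enum_distinct: "distinct (\<one>\<^bsub>G\<^esub> # concat (map (\<lambda>i. [\<sigma> i, inv\<^bsub>G\<^esub> (\<sigma> i)]) [1..<Suc m]))"
    and enum_all: "set (\<one>\<^bsub>G\<^esub> # concat (map (\<lambda>i. [\<sigma> i, inv\<^bsub>G\<^esub> (\<sigma> i)]) [1..<Suc m])) = carrier G"
  shows "is_direct_sum form_scale (alternating_forms \<iota>) {1..m} (\<lambda>i. galois_forms \<iota> (\<sigma> i)) \<and>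
    (\<forall>i\<in>{1..m}. vector_space.dim form_scale (galois_forms \<iota> (\<sigma> i)) = n) \<and>
    (\<forall>i\<in>{1..m}. \<forall>r. group.ord G (\<sigma> i) = 2 * r + 1 \<longrightarrow>
       (\<forall>f\<in>galois_forms \<iota> (\<sigma> i). f \<noteq> 0 \<longrightarrow>
          real (form_rank \<iota> f) = real n - real n / real (2 * r + 1)))"
proof -
  interpret finite_galois_extension \<iota> by (rule galois)
  define \<chi> where "\<chi> p = (if snd p then \<sigma> (fst p) else inv\<^bsub>G\<^esub> (\<sigma> (fst p)))" for p
  define xs where "xs = concat (map (\<lambda>i. [\<sigma> i, inv\<^bsub>G\<^esub> (\<sigma> i)]) [1..<Suc m])"
  let ?J = "{1..m} \<times> (UNIV :: bool set)"
  have one: "\<one>\<^bsub>G\<^esub> = id" by (simp add: G_def galois_group_def)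
  have \<chi>: "\<chi> (i, s) = (if s then \<sigma> i else inv\<^bsub>G\<^esub> (\<sigma> i))" for i s
    by (simp add: \<chi>_def)
  have "set xs = (\<Union>i\<in>{1..m}. {\<chi> (i, True), \<chi> (i, False)})"
    by (auto simp: xs_def \<chi> atLeastLessThanSuc_atLeastAtMost simp del: upt_Suc)
  then have img: "\<chi> ` ?J = set xs"
    by (auto simp: UNIV_bool)
  have dist: "id \<notin> set xs" "distinct xs" and all: "insert id (set xs) = carrier G"
    using enum_distinct enum_all unfolding xs_def[symmetric] one by simp_all
  have "length xs = 2 * m"
    by (simp add: xs_def length_concat comp_def sum_list_triv)
  \<comment> \<open>Injectivity by counting: the list has \<open>2 * m\<close> distinct entries, as
    many as there are index pairs.\<close>
  then have "card (\<chi> ` ?J) = card ?J"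
    using distinct_card[OF dist(2)] by (simp only: img card_cartesian_product) simp
  then have "inj_on \<chi> ?J" by (intro eq_card_imp_inj_on) auto
  moreover have "set xs = carrier G - {id}"
    using dist(1) all by auto
  ultimately have bij: "bij_betw \<chi> ?J (carrier G - {id})"
    unfolding bij_betw_def img by blast
  have in_G: "\<sigma> i \<in> carrier G" if "i \<in> {1..m}" for i
    using bij_betwE[OF bij] that by (metis DiffD1 SigmaI UNIV_I \<chi>)
  \<comment> \<open>The two elements come from different index pairs, so injectivity of
    \<open>\<chi>\<close> separates them.\<close>
  have ne: "inv\<^bsub>G\<^esub> (\<sigma> i) \<noteq> \<sigma> i" if "i \<in> {1..m}" for i
    using inj_onD[OF bij_betw_imp_inj_on[OF bij], of "(i, False)" "(i, True)"] that by (auto simp: \<chi>)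
  show ?thesis
  proof (intro conjI ballI allI impI)
    show "is_direct_sum form_scale (alternating_forms \<iota>) {1..m} (\<lambda>i. galois_forms \<iota> (\<sigma> i))"
      by (rule alternating_forms_direct_sum[where \<chi> = \<chi>]) (use \<chi> bij in \<open>simp_all add: G_def\<close>)
    show "vector_space.dim form_scale (galois_forms \<iota> (\<sigma> i)) = n" if "i \<in> {1..m}" for i
      using dim_galois_forms in_G[OF that] ne[OF that] by (simp add: degree G_def)
    show "real (form_rank \<iota> f) = real n - real n / real (2 * r + 1)"
      if "i \<in> {1..m}" "group.ord G (\<sigma> i) = 2 * r + 1" "f \<in> galois_forms \<iota> (\<sigma> i)" "f \<noteq> 0" for i r f
      using rank_galois_form[of "\<sigma> i" r f] in_G[OF that(1)] that by (simp add: degree G_def)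
  qed
qed

end
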